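(* Let $x=(x[1],\dots,x[d])$ have coordinates drawn i.i.d. from a distribution $\mathcal{D}_X$, and let $g_1(x),\dots,g_m(x)$ be nonlinear features that are orthonormal with respect to the inner product $\langle u,v\rangle=\mathbb{E}_x[uv]$. Consider the general nonlinear in-context learning task for the function class $f(x;w)=\sum_{i=1}^m w_ig_i(x)$ with $w_i\overset{i.i.d.}{\sim}\mathcal{N}(0,1)$. Let $\mathsf{TFB}$ be a Transformer block whose feed-forward layer (of any architecture) implements a kernel mapping $x\mapsto\widetilde x\in\mathbb{R}^{\bar d}$. Let $\widetilde d$ be the dimension of the orthogonal projection of $\widetilde x$ onto the span of $\{g_1(x),\dots,g_m(x)\}$ (that is, of the span of the orthogonal projections of the coordinates of $\widetilde x$, viewed as random variables). If $\widetilde d<m$, then the in-context learning loss satisfies $$\mathcal{L}(\mathsf{TFB})\ge m-\widetilde d.$$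
   Context: In the in-context learning task, $x_1,\dots,x_{n+1}$ are i.i.d. copies of $x$, independent of $w$; $y_i=f(x_i;w)$, $x_{\mathrm{query}}=x_{n+1}$, $y_{\mathrm{query}}=f(x_{n+1};w)$. The prompt is $$Z=\begin{bmatrix}1&\cdots&1&1\\ x_1&\cdots&x_n&x_{n+1}\\ \mathbf{0}&\cdots&\mathbf{0}&\mathbf{0}\\ y_1&\cdots&y_n&0\end{bmatrix}\in\mathbb{R}^{(\bar d+1)\times(n+1)}.$$ A Transformer block $\mathsf{TFB}$ is a feed-forward layer followed by a linear self-attention layer. The feed-forward layer implementing $x\mapsto\widetilde x$ maps $Z$ to $$\bar Z=\begin{bmatrix}\widetilde x_1&\cdots&\widetilde x_n&\widetilde x_{n+1}\\ y_1&\cdots&y_n&0\end{bmatrix},$$ where $\widetilde x_i\in\mathbb{R}^{\bar d}$ is the image of $x_i$ under a fixed map (the same for every column). The linear self-attention layer with weights $\mathbf{P},\mathbf{Q}\in\mathbb{R}^{(\bar d+1)\times(\bar d+1)}$ is $\mathsf{attn}(\bar Z)=\bar Z+\frac1n\mathbf{P}\bar ZM(\bar Z^\top\mathbf{Q}\bar Z)$, $M=\mathrm{diag}(\mathbf{I}_n,0)$. The prediction is $\hat y=\mathsf{attn}(\bar Z)[\bar d+1,n+1]$ and the in-context learning loss is $\mathcal{L}(\mathsf{TFB})=\mathbb{E}[(\hat y+y_{\mathrm{query}})^2]$, the expectation being over the inputs and $w$. *)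

theory Defs
  imports
    "HOL-Probability.Probability"
    "HOL-Library.Function_Algebras"
    "Jordan_Normal_Form.Matrix"
begin

unbundle no vec_syntax

text \<open>
  Indices start at 0: a vector of length \<open>k\<close> has coordinates \<open>0, \<dots>, k - 1\<close>, the samples are
  \<open>x 0, \<dots>, x n\<close>, and \<open>x n\<close> is the query. A point of \<open>d\<close>-dimensional space is a function
  \<open>nat \<Rightarrow> real\<close> in \<open>extensional {..<d}\<close>, which is the space of \<open>input_dist d D\<close>.
\<close>

type_synonym point = "nat \<Rightarrow> real"

definition input_dist :: "nat \<Rightarrow> real measure \<Rightarrow> point measure" where
  "input_dist d D = PiM {..<d} (\<lambda>_. D)"

definition weight_dist :: "nat \<Rightarrow> point measure" where
  "weight_dist m = PiM {..<m} (\<lambda>_. density lborel (\<lambda>t. ennreal (std_normal_density t)))"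

definition task_fun :: "nat \<Rightarrow> (nat \<Rightarrow> point \<Rightarrow> real) \<Rightarrow> point \<Rightarrow> point \<Rightarrow> real" where
  "task_fun m g w x = (\<Sum>i<m. w i * g i x)"


definition square_integrable :: "point measure \<Rightarrow> (point \<Rightarrow> real) \<Rightarrow> bool" where
  "square_integrable M u \<longleftrightarrow> u \<in> borel_measurable M \<and> integrable M (\<lambda>x. (u x)\<^sup>2)"

definition l2_inner :: "point measure \<Rightarrow> (point \<Rightarrow> real) \<Rightarrow> (point \<Rightarrow> real) \<Rightarrow> real" where
  "l2_inner M u v = (\<integral>x. u x * v x \<partial>M)"

definition orthonormal_features :: "point measure \<Rightarrow> nat \<Rightarrow> (nat \<Rightarrow> point \<Rightarrow> real) \<Rightarrow> bool" where
  "orthonormal_features M m g \<longleftrightarrow>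
     (\<forall>i<m. square_integrable M (g i)) \<and>
     (\<forall>i<m. \<forall>j<m. l2_inner M (g i) (g j) = (if i = j then 1 else 0))"

definition fun_scale :: "real \<Rightarrow> (point \<Rightarrow> real) \<Rightarrow> point \<Rightarrow> real" where
  "fun_scale c u = (\<lambda>x. c * u x)"

global_interpretation fun_space: vector_space fun_scale
  by unfold_locales (auto simp: fun_scale_def fun_eq_iff algebra_simps)

text \<open>
  Functions are not identified up to null sets. Below \<open>V\<close> is only the span of orthonormal
  \<open>g\<^sub>i\<close>; there almost everywhere equal functions are equal, so the projection is unique as a
  function, and dimensions of subspaces of \<open>V\<close> agree with those in \<open>L\<^sup>2\<close>.
\<close>

definition orth_proj :: "point measure \<Rightarrow> (point \<Rightarrow> real) set \<Rightarrow> (point \<Rightarrow> real) \<Rightarrow> point \<Rightarrow> real" where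
  "orth_proj M V u = (THE p. p \<in> V \<and> (\<forall>q\<in>V. l2_inner M (\<lambda>x. u x - p x) q = 0))"

text \<open>
  \<open>fun_space.dim S\<close> is the dimension of the span of \<open>S\<close>.
\<close>

definition proj_dim ::
  "point measure \<Rightarrow> nat \<Rightarrow> (nat \<Rightarrow> point \<Rightarrow> real) \<Rightarrow> nat \<Rightarrow> (point \<Rightarrow> real Matrix.vec) \<Rightarrow> nat" where
  "proj_dim M m g dbar \<phi> =
     fun_space.dim
       ((\<lambda>j. orth_proj M (fun_space.span (g ` {..<m})) (\<lambda>x. \<phi> x $ j)) ` {..<dbar})"

definition square_integrable_map :: "point measure \<Rightarrow> nat \<Rightarrow> (point \<Rightarrow> real Matrix.vec) \<Rightarrow> bool" where
  "square_integrable_map M dbar \<phi> \<longleftrightarrow>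
     (\<forall>x\<in>space M. \<phi> x \<in> carrier_vec dbar) \<and>
     (\<forall>j<dbar. square_integrable M (\<lambda>x. \<phi> x $ j))"


definition prompt :: "nat \<Rightarrow> nat \<Rightarrow> nat \<Rightarrow> (nat \<Rightarrow> point) \<Rightarrow> (nat \<Rightarrow> real) \<Rightarrow> real Matrix.mat" where
  "prompt d dbar n x y = Matrix.mat (dbar + 1) (n + 1) (\<lambda>(r, c).
     if r = 0 then 1
     else if r \<le> d then x c (r - 1)
     else if r < dbar then 0
     else if c < n then y c else 0)"

definition feature_prompt ::
  "nat \<Rightarrow> nat \<Rightarrow> (point \<Rightarrow> real Matrix.vec) \<Rightarrow> (nat \<Rightarrow> point) \<Rightarrow> (nat \<Rightarrow> real) \<Rightarrow> real Matrix.mat" where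
  "feature_prompt dbar n \<phi> x y = Matrix.mat (dbar + 1) (n + 1) (\<lambda>(r, c).
     if r < dbar then \<phi> (x c) $ r
     else if c < n then y c else 0)"

text \<open>
  The architecture of the feed-forward layer is left open: \<open>FF\<close> is any map on matrices that acts on
  prompts by applying \<open>\<phi>\<close> to the input part of each column.
\<close>

definition implements_kernel ::
  "nat \<Rightarrow> nat \<Rightarrow> nat \<Rightarrow> (real Matrix.mat \<Rightarrow> real Matrix.mat) \<Rightarrow> (point \<Rightarrow> real Matrix.vec) \<Rightarrow> bool" where
  "implements_kernel d dbar n FF \<phi> \<longleftrightarrow>
     (\<forall>x y. (\<forall>c\<le>n. x c \<in> extensional {..<d}) \<longrightarrow>
        FF (prompt d dbar n x y) = feature_prompt dbar n \<phi> x y)"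

definition attn_mask :: "nat \<Rightarrow> real Matrix.mat" where
  "attn_mask n = Matrix.mat (n + 1) (n + 1) (\<lambda>(i, j). if i = j \<and> i < n then 1 else 0)"

definition attn :: "nat \<Rightarrow> real Matrix.mat \<Rightarrow> real Matrix.mat \<Rightarrow> real Matrix.mat \<Rightarrow> real Matrix.mat" where
  "attn n P Q Z =
     Z + (1 / real n) \<cdot>\<^sub>m (P * Z * attn_mask n * (transpose_mat Z * Q * Z))"

definition tf_block ::
  "nat \<Rightarrow> (real Matrix.mat \<Rightarrow> real Matrix.mat) \<Rightarrow> real Matrix.mat \<Rightarrow> real Matrix.mat \<Rightarrow>
    real Matrix.mat \<Rightarrow> real Matrix.mat" where
  "tf_block n FF P Q Z = attn n P Q (FF Z)"

definition prediction ::
  "nat \<Rightarrow> nat \<Rightarrow> nat \<Rightarrow> (real Matrix.mat \<Rightarrow> real Matrix.mat) \<Rightarrow> real Matrix.mat \<Rightarrow> real Matrix.mat \<Rightarrow>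
    (nat \<Rightarrow> point) \<Rightarrow> (nat \<Rightarrow> real) \<Rightarrow> real" where
  "prediction d dbar n FF P Q x y = tf_block n FF P Q (prompt d dbar n x y) $$ (dbar, n)"

text \<open>
  The loss is a Lebesgue integral with values in \<open>[0, \<infinity>]\<close>, because the squared error need not be
  integrable. It adds \<open>y_query\<close>, since the prediction stands for \<open>- y_query\<close>.
\<close>

definition icl_loss ::
  "nat \<Rightarrow> real measure \<Rightarrow> nat \<Rightarrow> (nat \<Rightarrow> point \<Rightarrow> real) \<Rightarrow> nat \<Rightarrow> nat \<Rightarrow>
    (real Matrix.mat \<Rightarrow> real Matrix.mat) \<Rightarrow> real Matrix.mat \<Rightarrow> real Matrix.mat \<Rightarrow> ennreal" where
  "icl_loss d D m g dbar n FF P Q =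
     (\<integral>\<^sup>+ (x, w). ennreal ((prediction d dbar n FF P Q x (\<lambda>i. task_fun m g w (x i))
                           + task_fun m g w (x n))\<^sup>2)
        \<partial>(PiM {..n} (\<lambda>_. input_dist d D) \<Otimes>\<^sub>M weight_dist m))"

end

theory Submission
  imports Defs
begin

text \<open>
  The query column has label 0, so the prediction is linear in \<open>\<phi> (x n)\<close>, with coefficients
  depending only on the weights \<open>w\<close> and the other samples. By counting dimensions there are
  \<open>m - r\<close> orthonormal functions \<open>h\<^sub>l = (\<Sum>i<m. c l i * g i)\<close> orthogonal to the coordinates of
  \<open>\<phi>\<close>, where \<open>r\<close> is the dimension of the projection. With \<open>w\<close> and \<open>x 0, \<dots>, x (n - 1)\<close> fixed,
  Bessel's inequality bounds the mean squared error over the query from below by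
  \<open>\<Sum>l. (\<Sum>i<m. w i * c l i)\<^sup>2\<close>, whatever the coefficients of the prediction are. Its expectation
  over the Gaussian weights is \<open>\<Sum>l. \<Sum>i<m. (c l i)\<^sup>2 = m - r\<close>.
\<close>

subsection \<open>Linear systems\<close>

text \<open>Gaussian elimination by induction on the number \<open>k\<close> of equations. Either
  the last equation has only zero coefficients, or it has a pivot \<open>p\<close> that can be
  eliminated from the other equations, at the cost of one unknown and one equation.\<close>

lemma homogeneous_system_nontrivial:
  fixes a :: "nat \<Rightarrow> 'i \<Rightarrow> 'f::field"
  assumes "finite I" "k < card I"
  shows "\<exists>c. (\<exists>i\<in>I. c i \<noteq> 0) \<and> (\<forall>j<k. (\<Sum>i\<in>I. c i * a j i) = 0)"
  using assms
proof (induction k arbitrary: I a)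
  case 0
  then obtain i where "i \<in> I" by fastforce
  then show ?case by (intro exI[of _ "\<lambda>_. 1"]) auto
next
  case (Suc k)
  show ?case
  proof (cases "\<forall>i\<in>I. a k i = 0")
    case True
    obtain c where c: "\<exists>i\<in>I. c i \<noteq> 0" "\<forall>j<k. (\<Sum>i\<in>I. c i * a j i) = 0"
      using Suc.IH[of I a] Suc.prems by auto
    have "(\<Sum>i\<in>I. c i * a j i) = 0" if "j < Suc k" for j
      using that c True by (cases "j = k") auto
    then show ?thesis using c by blast
  next
    case False
    then obtain p where p: "p \<in> I" "a k p \<noteq> 0" by blast
    define J where "J = I - {p}"
    have J: "finite J" "k < card J" "I = insert p J" "p \<notin> J"
      using Suc.prems p by (auto simp: J_def card_Diff_singleton)
    \<comment> \<open>The reduced system: \<open>a j p / a k p\<close> times equation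
      \<open>k\<close> is subtracted from equation \<open>j\<close>, which removes the unknown
      \<open>p\<close>.\<close>
    obtain c where c: "\<exists>i\<in>J. c i \<noteq> 0"
      "\<forall>j<k. (\<Sum>i\<in>J. c i * (a j i - a j p * a k i / a k p)) = 0"
      using Suc.IH[OF J(1,2), of "\<lambda>j i. a j i - a j p * a k i / a k p"] by auto
    \<comment> \<open>Back substitution: the value at \<open>p\<close> is the one that solves
      equation \<open>k\<close>.\<close>
    define c' where "c' = c(p := - (\<Sum>i\<in>J. c i * a k i) / a k p)"
    have sum_c': "(\<Sum>i\<in>I. c' i * a j i) =
        (\<Sum>i\<in>J. c i * a j i) - (\<Sum>i\<in>J. c i * a k i) / a k p * a j p" for j
    proof -
      have "(\<Sum>i\<in>J. c' i * a j i) = (\<Sum>i\<in>J. c i * a j i)"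
        using J(4) by (intro sum.cong) (auto simp: c'_def)
      then show ?thesis using J by (simp add: c'_def)
    qed
    have "(\<Sum>i\<in>I. c' i * a j i) = 0" if "j < Suc k" for j
    proof (cases "j = k")
      case True
      then show ?thesis using p by (simp add: sum_c')
    next
      case False
      then have "(\<Sum>i\<in>J. c i * (a j i - a j p * a k i / a k p)) = 0"
        using c(2) that by auto
      also have "(\<Sum>i\<in>J. c i * (a j i - a j p * a k i / a k p)) = (\<Sum>i\<in>I. c' i * a j i)"
        by (simp add: sum_c' algebra_simps sum_subtractf sum_distrib_left sum_divide_distrib)
      finally show ?thesis .
    qed
    moreover have "\<exists>i\<in>I. c' i \<noteq> 0"
      using c(1) J(3,4) by (auto simp: c'_def)
    ultimately show ?thesis by blast
  qed
qed

text \<open>Gram-Schmidt in coordinates, one vector at a time. A new vector has to be orthogonal to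
  the \<open>r\<close> vectors \<open>b j\<close> and to the \<open>k\<close> vectors already built;
  these are fewer than \<open>m\<close> linear equations, so a nonzero solution exists, and it is
  then normalised.\<close>

lemma orthonormal_complement:
  fixes b :: "nat \<Rightarrow> nat \<Rightarrow> real"
  assumes "r + k \<le> m"
  shows "\<exists>c. (\<forall>l<k. \<forall>l'<k. (\<Sum>i<m. c l i * c l' i) = (if l = l' then 1 else 0)) \<and>
             (\<forall>l<k. \<forall>j<r. (\<Sum>i<m. c l i * b j i) = 0)"
  using assms
proof (induction k)
  case 0
  then show ?case by auto
next
  case (Suc k)
  then have "r + k \<le> m" by simp
  from Suc.IH[OF this] obtain c where
    "\<forall>l<k. \<forall>l'<k. (\<Sum>i<m. c l i * c l' i) = (if l = l' then 1 else 0)"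
    "\<forall>l<k. \<forall>j<r. (\<Sum>i<m. c l i * b j i) = 0"
    by blast
  then have
    c: "l < k \<Longrightarrow> l' < k \<Longrightarrow> (\<Sum>i<m. c l i * c l' i) = (if l = l' then 1 else 0)"
      "l < k \<Longrightarrow> j < r \<Longrightarrow> (\<Sum>i<m. c l i * b j i) = 0" for l l' j
    by auto
  \<comment> \<open>Equations with index below \<open>r\<close> come from \<open>b\<close>; equation
    \<open>r + l\<close> is orthogonality to \<open>c l\<close>.\<close>
  obtain e where e: "\<exists>i<m. e i \<noteq> 0"
    "\<And>j. j < r + k \<Longrightarrow> (\<Sum>i<m. e i * (if j < r then b j i else c (j - r) i)) = 0"
    using homogeneous_system_nontrivial[of "{..<m}" "r + k"
        "\<lambda>j i. if j < r then b j i else c (j - r) i"] Suc.prems by auto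
  have eb: "(\<Sum>i<m. e i * b j i) = 0" if "j < r" for j
    using e(2)[of j] that by simp
  have ec: "(\<Sum>i<m. e i * c l i) = 0" if "l < k" for l
    using e(2)[of "r + l"] that by simp
  define s where "s = sqrt (\<Sum>i<m. (e i)\<^sup>2)"
  have pos: "(\<Sum>i<m. (e i)\<^sup>2) > 0"
    using e(1) by (auto intro!: sum_pos2)
  then have s: "s > 0" "s * s = (\<Sum>i<m. (e i)\<^sup>2)" by (auto simp: s_def)
  define u where "u = (\<lambda>i. e i / s)"
  have su: "(\<Sum>i<m. u i * v i) = (\<Sum>i<m. e i * v i) / s" for v
    by (simp add: u_def sum_divide_distrib)
  have "(\<Sum>i<m. u i * u i) = (\<Sum>i<m. (e i)\<^sup>2) / (s * s)"
    by (simp add: u_def sum_divide_distrib power2_eq_square)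
  then have uu: "(\<Sum>i<m. u i * u i) = 1" using s pos by simp
  have uc: "(\<Sum>i<m. u i * c l i) = 0" if "l < k" for l
    using ec[OF that] by (simp add: su)
  have cu: "(\<Sum>i<m. c l i * u i) = 0" if "l < k" for l
    using uc[OF that] by (simp add: mult.commute)
  have ub: "(\<Sum>i<m. u i * b j i) = 0" if "j < r" for j
    using eb[OF that] by (simp add: su)
  show ?case
    by (intro exI[of _ "c(k := u)"]) (auto simp: less_Suc_eq c uu uc cu ub)
qed

subsection \<open>Square-integrable functions\<close>

text \<open>The linearity rules for \<open>l2_inner\<close> rest on this, since additivity of the
  Bochner integral requires integrable summands.\<close>

lemma square_integrable_mult_integrable:
  assumes "square_integrable M u" "square_integrable M v"
  shows "integrable M (\<lambda>x. u x * v x)"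
proof (rule Bochner_Integration.integrable_bound)
  show "integrable M (\<lambda>x. (u x)\<^sup>2 + (v x)\<^sup>2)"
    using assms by (auto simp: square_integrable_def)
  show "(\<lambda>x. u x * v x) \<in> borel_measurable M"
    using assms by (auto simp: square_integrable_def)
  have "\<bar>a * b\<bar> \<le> a\<^sup>2 + b\<^sup>2" for a b :: real
    using sum_squares_bound[of "\<bar>a\<bar>" "\<bar>b\<bar>"] mult_nonneg_nonneg[of "\<bar>a\<bar>" "\<bar>b\<bar>"]
    unfolding abs_mult power2_abs by linarith
  then show "AE x in M. norm (u x * v x) \<le> norm ((u x)\<^sup>2 + (v x)\<^sup>2)"
    by (intro AE_I2) simp
qed

lemma square_integrable_add:
  assumes "square_integrable M u" "square_integrable M v"
  shows "square_integrable M (\<lambda>x. u x + v x)"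
  using assms square_integrable_mult_integrable[OF assms]
  by (auto simp: square_integrable_def power2_sum mult.assoc)

lemma square_integrable_scale:
  assumes "square_integrable M u"
  shows "square_integrable M (\<lambda>x. c * u x)"
  using assms by (auto simp: square_integrable_def power_mult_distrib)

lemma square_integrable_sum:
  assumes "\<And>i. i \<in> I \<Longrightarrow> square_integrable M (u i)"
  shows "square_integrable M (\<lambda>x. \<Sum>i\<in>I. c i * u i x)"
proof (cases "finite I")
  case True
  then show ?thesis using assms
  proof (induction I)
    case empty
    then show ?case by (simp add: square_integrable_def)
  next
    case (insert i I)
    then show ?case by (simp add: square_integrable_add square_integrable_scale)
  qed
qed (simp add: square_integrable_def)

lemma square_integrable_diff:
  assumes "square_integrable M u" "square_integrable M v"
  shows "square_integrable M (\<lambda>x. u x - v x)"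
  using square_integrable_add[OF assms(1) square_integrable_scale[OF assms(2), of "-1"]] by simp

lemma l2_inner_commute: "l2_inner M u v = l2_inner M v u"
  by (simp add: l2_inner_def mult.commute)

lemma l2_inner_add_left:
  assumes "square_integrable M u" "square_integrable M v" "square_integrable M q"
  shows "l2_inner M (\<lambda>x. u x + v x) q = l2_inner M u q + l2_inner M v q"
  using assms by (simp add: l2_inner_def distrib_right square_integrable_mult_integrable)

lemma l2_inner_diff_left:
  assumes "square_integrable M u" "square_integrable M v" "square_integrable M q"
  shows "l2_inner M (\<lambda>x. u x - v x) q = l2_inner M u q - l2_inner M v q"
  using assms by (simp add: l2_inner_def left_diff_distrib square_integrable_mult_integrable)

lemma l2_inner_sum_left:
  assumes "\<And>i. i \<in> I \<Longrightarrow> square_integrable M (u i)" "square_integrable M v"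
  shows "l2_inner M (\<lambda>x. \<Sum>i\<in>I. c i * u i x) v = (\<Sum>i\<in>I. c i * l2_inner M (u i) v)"
  using assms
  by (simp add: l2_inner_def sum_distrib_right mult.assoc square_integrable_mult_integrable)

lemma l2_inner_sum_right:
  assumes "\<And>i. i \<in> I \<Longrightarrow> square_integrable M (u i)" "square_integrable M v"
  shows "l2_inner M v (\<lambda>x. \<Sum>i\<in>I. c i * u i x) = (\<Sum>i\<in>I. c i * l2_inner M v (u i))"
  using l2_inner_sum_left[OF assms] by (simp add: l2_inner_commute)

lemma orthonormal_features_inner_sum:
  assumes "orthonormal_features M m g" "j < m"
  shows "l2_inner M (\<lambda>x. \<Sum>i<m. c i * g i x) (g j) = c j"
proof -
  have "l2_inner M (\<lambda>x. \<Sum>i<m. c i * g i x) (g j) = (\<Sum>i<m. c i * l2_inner M (g i) (g j))"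
    using assms by (intro l2_inner_sum_left) (auto simp: orthonormal_features_def)
  also have "\<dots> = (\<Sum>i<m. if i = j then c i else 0)"
    using assms by (intro sum.cong) (auto simp: orthonormal_features_def)
  also have "\<dots> = c j" using assms(2) by simp
  finally show ?thesis .
qed

lemma orthonormal_features_square_integrable:
  assumes "orthonormal_features M m g"
  shows "square_integrable M (\<lambda>x. \<Sum>i<m. c i * g i x)"
  using assms by (intro square_integrable_sum) (auto simp: orthonormal_features_def)

text \<open>Passing from coefficient vectors to functions is an isometry. This turns orthonormal
  vectors \<open>c l\<close> into orthonormal functions.\<close>

lemma orthonormal_features_inner_sum_sum:
  assumes "orthonormal_features M m g"
  shows "l2_inner M (\<lambda>x. \<Sum>i<m. c i * g i x) (\<lambda>x. \<Sum>i<m. d i * g i x) = (\<Sum>i<m. c i * d i)"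
proof -
  have "l2_inner M (\<lambda>x. \<Sum>i<m. c i * g i x) (\<lambda>x. \<Sum>i<m. d i * g i x) =
      (\<Sum>i<m. d i * l2_inner M (\<lambda>x. \<Sum>i<m. c i * g i x) (g i))"
    using assms orthonormal_features_square_integrable[OF assms]
    by (intro l2_inner_sum_right) (auto simp: orthonormal_features_def)
  also have "\<dots> = (\<Sum>i<m. c i * d i)"
    using assms by (intro sum.cong) (auto simp: orthonormal_features_inner_sum)
  finally show ?thesis .
qed

text \<open>With \<open>p\<close> the projection of \<open>s\<close> onto the \<open>h l\<close>,
  both the inner product of \<open>s\<close> with \<open>p\<close> and that of \<open>p\<close> with
  itself equal the sum of squared coefficients. Expanding the nonnegative squared norm of
  \<open>s - p\<close> gives the claim.\<close>

lemma bessel_inequality: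
  assumes h: "orthonormal_features M k h" and s: "square_integrable M s"
  shows "(\<Sum>l<k. (l2_inner M s (h l))\<^sup>2) \<le> l2_inner M s s"
proof -
  define b where "b = (\<lambda>l. l2_inner M s (h l))"
  define p where "p = (\<lambda>x. \<Sum>l<k. b l * h l x)"
  have p: "square_integrable M p"
    unfolding p_def by (rule orthonormal_features_square_integrable[OF h])
  have sp: "l2_inner M s p = (\<Sum>l<k. (b l)\<^sup>2)"
    unfolding p_def using h s
    by (subst l2_inner_sum_right) (auto simp: orthonormal_features_def b_def power2_eq_square)
  have pp: "l2_inner M p p = (\<Sum>l<k. (b l)\<^sup>2)"
    unfolding p_def by (simp add: orthonormal_features_inner_sum_sum[OF h] power2_eq_square)
  have d: "square_integrable M (\<lambda>x. s x - p x)" by (rule square_integrable_diff[OF s p])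
  have "0 \<le> l2_inner M (\<lambda>x. s x - p x) (\<lambda>x. s x - p x)" by (simp add: l2_inner_def)
  also have "\<dots> = l2_inner M s (\<lambda>x. s x - p x) - l2_inner M p (\<lambda>x. s x - p x)"
    by (rule l2_inner_diff_left[OF s p d])
  also have "\<dots> = l2_inner M s s - l2_inner M s p - (l2_inner M s p - l2_inner M p p)"
    by (simp add: l2_inner_commute[of M _ "\<lambda>x. s x - p x"] l2_inner_diff_left s p
        l2_inner_commute[of M p s])
  finally show ?thesis by (simp add: sp pp b_def)
qed

subsection \<open>Orthogonal projection onto the span of the features\<close>

lemma sum_in_span:
  "(\<lambda>x. \<Sum>i\<in>I. c i * g i x) \<in> fun_space.span (g ` I)"
proof -
  have "(\<lambda>x. \<Sum>i\<in>I. c i * g i x) = (\<Sum>i\<in>I. fun_scale (c i) (g i))"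
  proof (cases "finite I")
    case True
    then show ?thesis
      by (induction I) (auto simp: fun_eq_iff fun_scale_def)
  qed (simp add: fun_eq_iff)
  also have "\<dots> \<in> fun_space.span (g ` I)"
    by (intro fun_space.span_sum fun_space.span_scale fun_space.span_base) auto
  finally show ?thesis .
qed

text \<open>The coefficients are indexed by \<open>I\<close> rather than by the functions
  themselves, to match the sums over \<open>i < m\<close> used elsewhere.\<close>

lemma span_imp_sum:
  assumes "v \<in> fun_space.span (g ` I)" "finite I"
  obtains c where "v = (\<lambda>x. \<Sum>i\<in>I. c i * g i x)"
proof -
  have "\<exists>c. v = (\<lambda>x. \<Sum>i\<in>I. c i * g i x)"
    using assms(1)
  proof (induction rule: fun_space.span_induct_alt)
    case base
    show ?case by (intro exI[of _ "\<lambda>_. 0"]) (simp add: fun_eq_iff)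
  next
    case (step e u v)
    then obtain i c where "i \<in> I" "u = g i" and v: "v = (\<lambda>x. \<Sum>i\<in>I. c i * g i x)" by auto
    have "(\<Sum>j\<in>I. (if j = i then e else 0) * g j x) = e * g i x" for x
    proof -
      have "(\<Sum>j\<in>I. (if j = i then e else 0) * g j x) = (\<Sum>j\<in>I. if j = i then e * g i x else 0)"
        by (intro sum.cong) auto
      then show ?thesis using assms(2) \<open>i \<in> I\<close> by simp
    qed
    then show ?case
      unfolding \<open>u = g i\<close> v
      by (intro exI[of _ "\<lambda>j. (if j = i then e else 0) + c j"])
        (simp add: fun_eq_iff fun_scale_def distrib_right sum.distrib)
  qed
  then show ?thesis using that by blast
qed

text \<open>Since \<open>orth_proj\<close> is a definite description, its properties become
  available only through existence and uniqueness. The Fourier sum of \<open>u\<close> gives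
  existence.\<close>

lemma orth_proj_span_orthonormal:
  assumes g: "orthonormal_features M m g" and u: "square_integrable M u"
  defines "V \<equiv> fun_space.span (g ` {..<m})"
  shows "orth_proj M V u \<in> V"
    and "\<And>q. q \<in> V \<Longrightarrow> l2_inner M (\<lambda>x. u x - orth_proj M V u x) q = 0"
proof -
  have gi: "\<And>i. i < m \<Longrightarrow> square_integrable M (g i)"
    using g by (auto simp: orthonormal_features_def)
  have gV: "\<And>i. i < m \<Longrightarrow> g i \<in> V" by (auto simp: V_def intro: fun_space.span_base)
  have "\<exists>!p. p \<in> V \<and> (\<forall>q\<in>V. l2_inner M (\<lambda>x. u x - p x) q = 0)"
  proof (rule ex_ex1I)
    define p where "p = (\<lambda>x. \<Sum>i<m. l2_inner M u (g i) * g i x)"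
    have p: "square_integrable M p"
      unfolding p_def by (rule orthonormal_features_square_integrable[OF g])
    have "l2_inner M (\<lambda>x. u x - p x) q = 0" if "q \<in> V" for q
    proof -
      from that obtain c where q: "q = (\<lambda>x. \<Sum>i<m. c i * g i x)"
        unfolding V_def by (rule span_imp_sum) auto
      have "l2_inner M (\<lambda>x. u x - p x) (g i) = 0" if "i < m" for i
        using that u p gi
        \<comment> \<open>Two stages: the difference is split while \<open>p\<close> is still
          folded, so that its square integrability applies; only then is \<open>p\<close>
          expanded.\<close>
        by (simp add: l2_inner_diff_left) (simp add: p_def orthonormal_features_inner_sum[OF g])
      then show ?thesis
        unfolding q using gi square_integrable_diff[OF u p] by (subst l2_inner_sum_right) auto
    qed
    then show "\<exists>p. p \<in> V \<and> (\<forall>q\<in>V. l2_inner M (\<lambda>x. u x - p x) q = 0)"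
      by (intro exI[of _ p]) (auto simp: p_def V_def intro: sum_in_span)
  next
    \<comment> \<open>Uniqueness: testing against \<open>g i\<close> forces the \<open>i\<close>-th
      coefficient of any projection to be the Fourier coefficient of \<open>u\<close>.\<close>
    have coeff: "c i = l2_inner M u (g i)"
      if "p = (\<lambda>x. \<Sum>i<m. c i * g i x)" "\<forall>q\<in>V. l2_inner M (\<lambda>x. u x - p x) q = 0" "i < m" for p c i
    proof -
      have p: "square_integrable M p"
        unfolding that by (rule orthonormal_features_square_integrable[OF g])
      have "0 = l2_inner M (\<lambda>x. u x - p x) (g i)" using that gV by auto
      also have "\<dots> = l2_inner M u (g i) - c i"
        using that(3) u p gi
        by (simp add: l2_inner_diff_left) (simp add: that(1) orthonormal_features_inner_sum[OF g])
      finally show ?thesis by simp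
    qed
    fix p p'
    assume "p \<in> V \<and> (\<forall>q\<in>V. l2_inner M (\<lambda>x. u x - p x) q = 0)"
      and "p' \<in> V \<and> (\<forall>q\<in>V. l2_inner M (\<lambda>x. u x - p' x) q = 0)"
    then have p: "p \<in> V" "\<forall>q\<in>V. l2_inner M (\<lambda>x. u x - p x) q = 0"
      and p': "p' \<in> V" "\<forall>q\<in>V. l2_inner M (\<lambda>x. u x - p' x) q = 0" by auto
    obtain c where c: "p = (\<lambda>x. \<Sum>i<m. c i * g i x)"
      using p(1) unfolding V_def by (rule span_imp_sum) auto
    obtain c' where c': "p' = (\<lambda>x. \<Sum>i<m. c' i * g i x)"
      using p'(1) unfolding V_def by (rule span_imp_sum) auto
    have "c i = c' i" if "i < m" for i
      using coeff[OF c p(2) that] coeff[OF c' p'(2) that] by simp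
    then show "p = p'" unfolding c c' by (intro ext sum.cong) auto
  qed
  from theI'[OF this] show "orth_proj M V u \<in> V"
    and "\<And>q. q \<in> V \<Longrightarrow> l2_inner M (\<lambda>x. u x - orth_proj M V u x) q = 0"
    unfolding orth_proj_def by auto
qed

text \<open>The dimension hypothesis enters here. The projections are spanned by \<open>r\<close> of
  their number, so orthogonality to all of them amounts to \<open>r\<close> linear conditions on
  coefficient vectors of length \<open>m\<close>, which leaves room for \<open>k\<close> orthonormal
  solutions.\<close>

lemma obtain_orthonormal_orthogonal_to_projections:
  assumes g: "orthonormal_features M m g"
    and \<phi>: "\<And>j. j < dbar \<Longrightarrow> square_integrable M (\<lambda>x. \<phi> x $ j)"
    and le: "proj_dim M m g dbar \<phi> + k \<le> m"
  obtains c where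
    "orthonormal_features M k (\<lambda>l x. \<Sum>i<m. c l i * g i x)"
    "\<And>l l'. l < k \<Longrightarrow> l' < k \<Longrightarrow> (\<Sum>i<m. c l i * c l' i) = (if l = l' then 1 else 0)"
    "\<And>l j. l < k \<Longrightarrow> j < dbar \<Longrightarrow> l2_inner M (\<lambda>x. \<phi> x $ j) (\<lambda>x. \<Sum>i<m. c l i * g i x) = 0"
proof -
  define V where "V = fun_space.span (g ` {..<m})"
  define p where "p = (\<lambda>j. orth_proj M V (\<lambda>x. \<phi> x $ j))"
  define r where "r = proj_dim M m g dbar \<phi>"
  have gi: "\<And>i. i < m \<Longrightarrow> square_integrable M (g i)"
    using g by (auto simp: orthonormal_features_def)
  have V: "square_integrable M v" if "v \<in> V" for v
    using that unfolding V_def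
    by (rule span_imp_sum) (auto simp: orthonormal_features_square_integrable[OF g])
  have pV: "p j \<in> V" if "j < dbar" for j
    unfolding p_def V_def by (rule orth_proj_span_orthonormal[OF g \<phi>[OF that]])
  have r: "r = fun_space.dim (p ` {..<dbar})"
    by (simp add: r_def proj_dim_def p_def V_def)
  \<comment> \<open>The basis is taken among the projections, so it is finite and lies in
    \<open>V\<close>.\<close>
  obtain B where B: "B \<subseteq> p ` {..<dbar}" "p ` {..<dbar} \<subseteq> fun_space.span B" "card B = r"
    unfolding r by (rule fun_space.basis_exists) auto
  have "finite B" using B(1) by (rule finite_subset) simp
  then obtain b where "bij_betw b {0..<card B} B" using ex_bij_betw_nat_finite by blast
  then have b: "B = b ` {..<r}" using B(3) by (auto simp: bij_betw_def lessThan_atLeast0)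
  \<comment> \<open>\<open>l2_inner M (b j) (g i)\<close> is the \<open>i\<close>-th coordinate of
    \<open>b j\<close> with respect to the features.\<close>
  obtain c where c:
    "\<And>l l'. l < k \<Longrightarrow> l' < k \<Longrightarrow> (\<Sum>i<m. c l i * c l' i) = (if l = l' then 1 else 0)"
    "\<And>l j. l < k \<Longrightarrow> j < r \<Longrightarrow> (\<Sum>i<m. c l i * l2_inner M (b j) (g i)) = 0"
    using orthonormal_complement[of r k m "\<lambda>j i. l2_inner M (b j) (g i)"] le r_def by blast
  define h where "h = (\<lambda>l x. \<Sum>i<m. c l i * g i x)"
  have h: "square_integrable M (h l)" "h l \<in> V" for l
    unfolding h_def V_def
    by (auto intro: orthonormal_features_square_integrable[OF g] sum_in_span)
  have "l2_inner M (\<lambda>x. \<phi> x $ j) (h l) = 0" if "l < k" "j < dbar" for l j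
  proof -
    \<comment> \<open>\<open>W\<close> is a subspace containing \<open>B\<close>, hence containing
      every projection \<open>p j\<close>.\<close>
    define W where "W = {v \<in> V. l2_inner M v (h l) = 0}"
    have "fun_space.subspace W"
    proof (rule fun_space.subspaceI)
      show "0 \<in> W" by (simp add: W_def V_def fun_space.span_zero l2_inner_def)
    next
      fix u v assume "u \<in> W" "v \<in> W"
      then show "u + v \<in> W"
        using l2_inner_add_left[OF V V h(1), of u v l]
        by (auto simp: W_def V_def plus_fun_def intro: fun_space.span_add[unfolded plus_fun_def])
    next
      fix a u assume "u \<in> W"
      then have "fun_scale a u \<in> V" by (auto simp: W_def V_def intro: fun_space.span_scale)
      moreover have "l2_inner M (fun_scale a u) (h l) = 0"
        using \<open>u \<in> W\<close> by (simp add: W_def l2_inner_def mult.assoc fun_scale_def)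
      ultimately show "fun_scale a u \<in> W" by (simp add: W_def)
    qed
    moreover have "B \<subseteq> W"
    proof
      fix v assume "v \<in> B"
      then obtain t where t: "v = b t" "t < r" using b by auto
      have vV: "v \<in> V" using \<open>v \<in> B\<close> B(1) pV by auto
      have "l2_inner M v (h l) = (\<Sum>i<m. c l i * l2_inner M v (g i))"
        unfolding h_def using gi V[OF vV] by (intro l2_inner_sum_right) auto
      also have "\<dots> = 0" using c(2)[OF \<open>l < k\<close> t(2)] t(1) by simp
      finally show "v \<in> W" using vV by (simp add: W_def)
    qed
    ultimately have "fun_space.span B \<subseteq> W" by (intro fun_space.span_minimal)
    then have ph: "l2_inner M (p j) (h l) = 0" using B(2) \<open>j < dbar\<close> by (auto simp: W_def)
    \<comment> \<open>The residual of the projection is orthogonal to \<open>V\<close>, which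
      contains \<open>h l\<close>; so \<phi> and its projection have the same inner product with
      \<open>h l\<close>.\<close>
    have "0 = l2_inner M (\<lambda>x. \<phi> x $ j - p j x) (h l)"
      unfolding p_def V_def
      using orth_proj_span_orthonormal(2)[OF g \<phi>[OF \<open>j < dbar\<close>]] h(2)[of l] by (simp add: V_def)
    also have "\<dots> = l2_inner M (\<lambda>x. \<phi> x $ j) (h l)"
      using \<phi>[OF \<open>j < dbar\<close>] V[OF pV[OF \<open>j < dbar\<close>]] h(1) by (simp add: l2_inner_diff_left ph)
    finally show ?thesis by simp
  qed
  moreover have "orthonormal_features M k h"
    using c(1) h(1) unfolding orthonormal_features_def h_def
    by (simp add: orthonormal_features_inner_sum_sum[OF g])
  ultimately show ?thesis using that[of c] c(1) by (simp add: h_def)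
qed

subsection \<open>Gaussian second moments\<close>

lemma prob_space_std_normal:
  "prob_space (density lborel (\<lambda>t. ennreal (std_normal_density t)))"
  using prob_space_normal_density[of 1 0] by simp

lemma std_normal_moments:
  fixes N :: "real measure"
  defines "N \<equiv> density lborel (\<lambda>t. ennreal (std_normal_density t))"
  shows "integrable N (\<lambda>t. t)" "integrable N (\<lambda>t. t * t)"
    "(\<integral>t. t \<partial>N) = 0" "(\<integral>t. t * t \<partial>N) = 1"
  using integrable_std_normal_moment[of 1] integrable_std_normal_moment[of 2]
    integral_std_normal_moment_odd[of 0] integral_std_normal_moment_even[of 1]
  unfolding N_def
  by (simp_all add: integrable_density integral_density power2_eq_square)

text \<open>The integrand is a product of functions of single coordinates, so its integral factors.
  For \<open>i\<close> different from \<open>j\<close> the factors at \<open>i\<close> and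
  \<open>j\<close> are means, hence zero; for \<open>i = j\<close> the only nontrivial factor is the
  variance.\<close>

lemma weight_dist_second_moment:
  assumes "i < m" "j < m"
  shows "integrable (weight_dist m) (\<lambda>w. w i * w j)"
    and "(\<integral>w. w i * w j \<partial>weight_dist m) = (if i = j then 1 else 0)"
proof -
  define N where "N = density lborel (\<lambda>t. ennreal (std_normal_density t))"
  interpret N: prob_space N unfolding N_def by (rule prob_space_std_normal)
  interpret product_sigma_finite "\<lambda>_::nat. N" by standard
  \<comment> \<open>Two conditionals are multiplied so that for \<open>i = j\<close> both fall on
    the same coordinate and give \<open>t * t\<close>.\<close>
  define f where "f = (\<lambda>k t::real. (if k = i then t else 1) * (if k = j then t else 1))"
  have f: "integrable N (f k)" "(\<integral>t. f k t \<partial>N) =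
      (if k = i then if k = j then 1 else 0 else if k = j then 0 else 1)" for k
    using std_normal_moments[folded N_def]
    by (cases "k = i"; cases "k = j"; simp add: f_def N.prob_space)+
  have prod: "(\<Prod>k<m. f k (w k)) = w i * w j" for w
    using assms by (simp add: f_def prod.distrib)
  show "integrable (weight_dist m) (\<lambda>w. w i * w j)"
    using product_integrable_prod[of "{..<m}" f] f
    by (simp add: weight_dist_def N_def[symmetric] prod)
  have "(\<integral>w. w i * w j \<partial>weight_dist m) = (\<Prod>k<m. \<integral>t. f k t \<partial>N)"
    using product_integral_prod[of "{..<m}" f] f
    by (simp add: weight_dist_def N_def[symmetric] prod)
  also have "\<dots> = (if i = j then 1 else 0)"
    using assms by (auto simp: f(2) intro!: prod.neutral prod_zero)
  finally show "(\<integral>w. w i * w j \<partial>weight_dist m) = (if i = j then 1 else 0)" .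
qed

text \<open>The covariance matrix of the weights is the identity, so only the diagonal of the
  expanded square survives.\<close>

lemma weight_dist_sum_square:
  shows "integrable (weight_dist m) (\<lambda>w. (\<Sum>i<m. w i * c i)\<^sup>2)"
    and "(\<integral>w. (\<Sum>i<m. w i * c i)\<^sup>2 \<partial>weight_dist m) = (\<Sum>i<m. (c i)\<^sup>2)"
proof -
  have eq: "(\<Sum>i<m. w i * c i)\<^sup>2 = (\<Sum>i<m. \<Sum>j<m. c i * c j * (w i * w j))" for w
    by (simp add: power2_eq_square sum_product ac_simps)
  have int: "integrable (weight_dist m) (\<lambda>w. c i * c j * (w i * w j))" if "i < m" "j < m" for i j
    using weight_dist_second_moment(1)[OF that] by simp
  show "integrable (weight_dist m) (\<lambda>w. (\<Sum>i<m. w i * c i)\<^sup>2)"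
    unfolding eq by (intro Bochner_Integration.integrable_sum int) auto
  have "(\<integral>w. (\<Sum>i<m. w i * c i)\<^sup>2 \<partial>weight_dist m) =
      (\<Sum>i<m. \<integral>w. (\<Sum>j<m. c i * c j * (w i * w j)) \<partial>weight_dist m)"
    unfolding eq by (intro Bochner_Integration.integral_sum Bochner_Integration.integrable_sum int) auto
  also have "\<dots> = (\<Sum>i<m. \<Sum>j<m. \<integral>w. c i * c j * (w i * w j) \<partial>weight_dist m)"
    by (intro sum.cong refl Bochner_Integration.integral_sum int) auto
  also have "\<dots> = (\<Sum>i<m. \<Sum>j<m. c i * c j * (\<integral>w. w i * w j \<partial>weight_dist m))"
    by simp
  also have "\<dots> = (\<Sum>i<m. \<Sum>j<m. if i = j then c i * c j else 0)"
    by (intro sum.cong) (auto simp: weight_dist_second_moment(2))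
  also have "\<dots> = (\<Sum>i<m. (c i)\<^sup>2)" by (simp add: power2_eq_square)
  finally show "(\<integral>w. (\<Sum>i<m. w i * c i)\<^sup>2 \<partial>weight_dist m) = (\<Sum>i<m. (c i)\<^sup>2)" .
qed

subsection \<open>The prediction of a Transformer block\<close>

text \<open>For \<open>k < dbar\<close> this is entry \<open>(dbar, k)\<close> of
  \<open>P Z M Z^T Q / n\<close>, with \<open>Z\<close> the feature prompt. The mask
  \<open>M\<close> limits the sum to \<open>c < n\<close>, so the query does not occur.\<close>

definition attn_coeff ::
  "nat \<Rightarrow> nat \<Rightarrow> (point \<Rightarrow> real Matrix.vec) \<Rightarrow> real Matrix.mat \<Rightarrow> real Matrix.mat \<Rightarrow>
    (nat \<Rightarrow> point) \<Rightarrow> (nat \<Rightarrow> real) \<Rightarrow> nat \<Rightarrow> real" where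
  "attn_coeff dbar n \<phi> P Q x y k = (1 / real n) * (\<Sum>c<n.
     ((\<Sum>r<dbar. P $$ (dbar, r) * \<phi> (x c) $ r) + P $$ (dbar, dbar) * y c) *
     ((\<Sum>s<dbar. \<phi> (x c) $ s * Q $$ (s, k)) + y c * Q $$ (dbar, k)))"

lemma prediction_eq_linear_in_query:
  assumes "implements_kernel d dbar n FF \<phi>"
    and x: "\<And>c. c \<le> n \<Longrightarrow> x c \<in> extensional {..<d}"
    and P: "P \<in> carrier_mat (dbar + 1) (dbar + 1)"
    and Q: "Q \<in> carrier_mat (dbar + 1) (dbar + 1)"
  shows "prediction d dbar n FF P Q x y =
    (\<Sum>k<dbar. attn_coeff dbar n \<phi> P Q x y k * \<phi> (x n) $ k)"
proof -
  define Z where "Z = feature_prompt dbar n \<phi> x y"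
  have Z: "Z \<in> carrier_mat (dbar + 1) (n + 1)" by (simp add: Z_def feature_prompt_def)
  have Zc: "Z $$ (r, c) = (if r < dbar then \<phi> (x c) $ r else y c)" if "c < n" "r < dbar + 1" for r c
    using that by (simp add: Z_def feature_prompt_def)
  have Zn: "Z $$ (r, n) = (if r < dbar then \<phi> (x n) $ r else 0)" if "r < dbar + 1" for r
    using that by (simp add: Z_def feature_prompt_def)
  have M: "attn_mask n \<in> carrier_mat (n + 1) (n + 1)" by (simp add: attn_mask_def)
  have mat: "(A * B) $$ (i, j) = (\<Sum>k<q. A $$ (i, k) * B $$ (k, j))"
    if "A \<in> carrier_mat p q" "B \<in> carrier_mat q r" "i < p" "j < r" for A B :: "real mat" and p q r i j
    using that by (simp add: scalar_prod_def lessThan_atLeast0)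
  have PZ: "P * Z \<in> carrier_mat (dbar + 1) (n + 1)" using P Z by simp
  have PZM: "P * Z * attn_mask n \<in> carrier_mat (dbar + 1) (n + 1)" using PZ M by simp
  have ZQ: "transpose_mat Z * Q \<in> carrier_mat (n + 1) (dbar + 1)" using Q Z by simp
  have ZQZ: "transpose_mat Z * Q * Z \<in> carrier_mat (n + 1) (n + 1)" using ZQ Z by simp
  have PZM': "(P * Z * attn_mask n) $$ (dbar, c) = (if c < n then (P * Z) $$ (dbar, c) else 0)"
    if "c < n + 1" for c
  proof -
    have "(P * Z * attn_mask n) $$ (dbar, c) =
        (\<Sum>k<n + 1. (P * Z) $$ (dbar, k) * attn_mask n $$ (k, c))"
      using that by (intro mat[OF PZ M]) auto
    also have "\<dots> = (\<Sum>k<n + 1. if k = c then (if c < n then (P * Z) $$ (dbar, c) else 0) else 0)"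
      using that by (intro sum.cong) (auto simp: attn_mask_def)
    also have "\<dots> = (if c < n then (P * Z) $$ (dbar, c) else 0)" using that by simp
    finally show ?thesis .
  qed
  have PZ': "(P * Z) $$ (dbar, c) = (\<Sum>r<dbar. P $$ (dbar, r) * \<phi> (x c) $ r) + P $$ (dbar, dbar) * y c"
    if "c < n" for c
    using that by (subst mat[OF P Z]) (auto simp: Zc)
  have ZQ': "(transpose_mat Z * Q) $$ (c, k) = (\<Sum>s<dbar. \<phi> (x c) $ s * Q $$ (s, k)) + y c * Q $$ (dbar, k)"
    if "c < n" "k < dbar + 1" for c k
    using that Z by (subst mat[of "transpose_mat Z" "n + 1" "dbar + 1" Q "dbar + 1"]) (use Q in \<open>auto simp: Zc\<close>)
  \<comment> \<open>The row index runs up to \<open>dbar\<close>, but the last term vanishes because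
    the label slot of the query column holds 0.\<close>
  have ZQZ': "(transpose_mat Z * Q * Z) $$ (c, n) =
      (\<Sum>k<dbar. ((\<Sum>s<dbar. \<phi> (x c) $ s * Q $$ (s, k)) + y c * Q $$ (dbar, k)) * \<phi> (x n) $ k)"
    if "c < n" for c
    using that by (subst mat[OF ZQ Z]) (auto simp: Zn ZQ')
  have attn: "(Z + a \<cdot>\<^sub>m (A * B)) $$ (dbar, n) = Z $$ (dbar, n) + a * (A * B) $$ (dbar, n)"
    if "A \<in> carrier_mat (dbar + 1) (n + 1)" "B \<in> carrier_mat (n + 1) (n + 1)" for A B a
    using that by simp
  have "prediction d dbar n FF P Q x y =
      Z $$ (dbar, n) + 1 / real n * (P * Z * attn_mask n * (transpose_mat Z * Q * Z)) $$ (dbar, n)"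
    using assms(1) x attn[OF PZM ZQZ]
    unfolding prediction_def tf_block_def attn_def implements_kernel_def Z_def by presburger
  also have "(P * Z * attn_mask n * (transpose_mat Z * Q * Z)) $$ (dbar, n) =
      (\<Sum>c<n + 1. (P * Z * attn_mask n) $$ (dbar, c) * (transpose_mat Z * Q * Z) $$ (c, n))"
    by (intro mat[OF PZM ZQZ]) auto
  also have "\<dots> = (\<Sum>c<n. (P * Z) $$ (dbar, c) * (transpose_mat Z * Q * Z) $$ (c, n))"
    by (simp add: PZM')
  also have "\<dots> = (\<Sum>c<n. \<Sum>k<dbar. (P * Z) $$ (dbar, c) *
      ((\<Sum>s<dbar. \<phi> (x c) $ s * Q $$ (s, k)) + y c * Q $$ (dbar, k)) * \<phi> (x n) $ k)"
    by (intro sum.cong) (auto simp: ZQZ' sum_distrib_left mult.assoc)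
  also have "\<dots> = (\<Sum>k<dbar. \<Sum>c<n. (P * Z) $$ (dbar, c) *
      ((\<Sum>s<dbar. \<phi> (x c) $ s * Q $$ (s, k)) + y c * Q $$ (dbar, k)) * \<phi> (x n) $ k)"
    by (rule sum.swap)
  finally show ?thesis
    by (simp add: Zn attn_coeff_def PZ' sum_distrib_left sum_distrib_right mult.assoc)
qed

text \<open>This allows the query \<open>x n\<close> to vary while the coefficients stay
  fixed.\<close>

lemma attn_coeff_cong:
  assumes "\<And>c. c < n \<Longrightarrow> x c = x' c" "\<And>c. c < n \<Longrightarrow> y c = y' c"
  shows "attn_coeff dbar n \<phi> P Q x y k = attn_coeff dbar n \<phi> P Q x' y' k"
  using assms by (simp add: attn_coeff_def)

lemma borel_measurable_attn_coeff:
  assumes "\<And>c r. c < n \<Longrightarrow> r < dbar \<Longrightarrow> (\<lambda>z. \<phi> (x z c) $ r) \<in> borel_measurable N"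
    and "\<And>c. c < n \<Longrightarrow> (\<lambda>z. y z c) \<in> borel_measurable N"
  shows "(\<lambda>z. attn_coeff dbar n \<phi> P Q (x z) (y z) k) \<in> borel_measurable N"
  unfolding attn_coeff_def
  by (intro borel_measurable_times borel_measurable_sum borel_measurable_add
      borel_measurable_const assms) auto

text \<open>Pairing the error with an \<open>h l\<close> annihilates the prediction and leaves the
  coefficient of the task function along \<open>h l\<close>. Bessel then gives a bound free of
  \<open>a\<close>.\<close>

lemma orthogonal_linear_error_lower_bound:
  assumes g: "orthonormal_features M m g"
    and h: "orthonormal_features M K (\<lambda>l x. \<Sum>i<m. c l i * g i x)"
    and \<phi>: "\<And>j. j < dbar \<Longrightarrow> square_integrable M (\<lambda>x. \<phi> x $ j)"
    and orth: "\<And>l j. l < K \<Longrightarrow> j < dbar \<Longrightarrow>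
      l2_inner M (\<lambda>x. \<phi> x $ j) (\<lambda>x. \<Sum>i<m. c l i * g i x) = 0"
  shows "ennreal (\<Sum>l<K. (\<Sum>i<m. w i * c l i)\<^sup>2) \<le>
    (\<integral>\<^sup>+x. ennreal (((\<Sum>k<dbar. a k * \<phi> x $ k) + task_fun m g w x)\<^sup>2) \<partial>M)"
proof -
  define s where "s = (\<lambda>x. (\<Sum>k<dbar. a k * \<phi> x $ k) + task_fun m g w x)"
  have u: "square_integrable M (\<lambda>x. \<Sum>k<dbar. a k * \<phi> x $ k)"
    using \<phi> by (intro square_integrable_sum) auto
  have v: "square_integrable M (task_fun m g w)"
    using orthonormal_features_square_integrable[OF g] by (simp add: task_fun_def[abs_def])
  have s: "square_integrable M s" unfolding s_def by (rule square_integrable_add[OF u v])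
  have "l2_inner M s (\<lambda>x. \<Sum>i<m. c l i * g i x) = (\<Sum>i<m. w i * c l i)" if "l < K" for l
  proof -
    have hl: "square_integrable M (\<lambda>x. \<Sum>i<m. c l i * g i x)"
      by (rule orthonormal_features_square_integrable[OF g])
    have "l2_inner M (\<lambda>x. \<Sum>k<dbar. a k * \<phi> x $ k) (\<lambda>x. \<Sum>i<m. c l i * g i x) = 0"
      using \<phi> orth[OF that] hl by (subst l2_inner_sum_left) auto
    then show ?thesis
      unfolding s_def using l2_inner_add_left[OF u v hl]
      by (simp add: task_fun_def[abs_def] orthonormal_features_inner_sum_sum[OF g])
  qed
  then have "(\<Sum>l<K. (\<Sum>i<m. w i * c l i)\<^sup>2) \<le> l2_inner M s s"
    using bessel_inequality[OF h s] by simp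
  also have "l2_inner M s s = (\<integral>x. (s x)\<^sup>2 \<partial>M)" by (simp add: l2_inner_def power2_eq_square)
  finally have "ennreal (\<Sum>l<K. (\<Sum>i<m. w i * c l i)\<^sup>2) \<le> ennreal (\<integral>x. (s x)\<^sup>2 \<partial>M)"
    by (rule ennreal_leI)
  also have "\<dots> = (\<integral>\<^sup>+x. ennreal ((s x)\<^sup>2) \<partial>M)"
    using s by (intro nn_integral_eq_integral[symmetric]) (auto simp: square_integrable_def)
  finally show ?thesis by (simp add: s_def)
qed

section \<open>Averaging over the query, the other samples and the weights\<close>

theorem corollary9:
  fixes d m n dbar :: nat
    and D :: "real measure"
    and g :: "nat \<Rightarrow> point \<Rightarrow> real"
    and \<phi> :: "point \<Rightarrow> real Matrix.vec"
    and FF :: "real Matrix.mat \<Rightarrow> real Matrix.mat"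
    and P Q :: "real Matrix.mat"
  assumes "prob_space D" and "sets D = sets borel"
    and "0 < n" and "d + 1 \<le> dbar"
    and "orthonormal_features (input_dist d D) m g"
    and "square_integrable_map (input_dist d D) dbar \<phi>"
    and "implements_kernel d dbar n FF \<phi>"
    and "P \<in> carrier_mat (dbar + 1) (dbar + 1)"
    and "Q \<in> carrier_mat (dbar + 1) (dbar + 1)"
    and "proj_dim (input_dist d D) m g dbar \<phi> < m"
  shows "icl_loss d D m g dbar n FF P Q
           \<ge> ennreal (real m - real (proj_dim (input_dist d D) m g dbar \<phi>))"
proof -
  define X where "X = input_dist d D"
  define W where "W = weight_dist m"
  define r where "r = proj_dim X m g dbar \<phi>"
  define K where "K = m - r"
  have rm: "r < m" using assms(10) by (simp add: r_def X_def)
  have g: "orthonormal_features X m g" using assms(5) by (simp add: X_def)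
  have \<phi>: "\<And>j. j < dbar \<Longrightarrow> square_integrable X (\<lambda>x. \<phi> x $ j)"
    using assms(6) by (simp add: X_def square_integrable_map_def)
  obtain c where
    h: "orthonormal_features X K (\<lambda>l x. \<Sum>i<m. c l i * g i x)" and
    c: "\<And>l l'. l < K \<Longrightarrow> l' < K \<Longrightarrow> (\<Sum>i<m. c l i * c l' i) = (if l = l' then 1 else 0)" and
    orth: "\<And>l j. l < K \<Longrightarrow> j < dbar \<Longrightarrow>
      l2_inner X (\<lambda>x. \<phi> x $ j) (\<lambda>x. \<Sum>i<m. c l i * g i x) = 0"
    using obtain_orthonormal_orthogonal_to_projections[OF g, of dbar \<phi> K] \<phi> rm
    by (simp add: K_def r_def) blast
  interpret X: prob_space X
    unfolding X_def input_dist_def using assms(1) by (intro prob_space_PiM)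
  interpret W: prob_space W
    unfolding W_def weight_dist_def by (intro prob_space_PiM prob_space_std_normal)
  interpret XS: product_prob_space "\<lambda>_::nat. X" UNIV by standard
  interpret XI: prob_space "PiM {..n} (\<lambda>_. X)" by (intro prob_space_PiM X.prob_space_axioms)
  interpret XJ: prob_space "PiM {..<n} (\<lambda>_. X)" by (intro prob_space_PiM X.prob_space_axioms)
  interpret XW: pair_sigma_finite "PiM {..n} (\<lambda>_. X)" W by standard
  have g_meas: "(\<lambda>x. g i x) \<in> borel_measurable X" if "i < m" for i
    using g that by (auto simp: orthonormal_features_def square_integrable_def)
  have \<phi>_meas: "(\<lambda>x. \<phi> x $ j) \<in> borel_measurable X" if "j < dbar" for j
    using \<phi> that by (auto simp: square_integrable_def)
  have w_meas: "(\<lambda>w. w i) \<in> borel_measurable W" if "i < m" for i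
  proof -
    let ?N = "density lborel (\<lambda>t. ennreal (std_normal_density t))"
    have "(\<lambda>w. w i) \<in> measurable W ?N"
      unfolding W_def weight_dist_def using that by (intro measurable_component_singleton) auto
    also have "measurable W ?N = borel_measurable W" by (intro measurable_cong_sets) auto
    finally show ?thesis .
  qed
  \<comment> \<open>\<open>F\<close> replaces the error by its explicit formula. \<open>FF\<close>
    is constrained only on prompts with extensional inputs, so the two are compared on the sample
    space, while measurability is shown for \<open>F\<close>.\<close>
  define F where "F = (\<lambda>x w.
    (\<Sum>k<dbar. attn_coeff dbar n \<phi> P Q x (\<lambda>i. task_fun m g w (x i)) k * \<phi> (x n) $ k)
      + task_fun m g w (x n))"
  have F_eq: "prediction d dbar n FF P Q x (\<lambda>i. task_fun m g w (x i)) + task_fun m g w (x n) = F x w"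
    if "x \<in> space (PiM {..n} (\<lambda>_. X))" for x w
  proof -
    have "x i \<in> extensional {..<d}" if "i \<le> n" for i
      using \<open>x \<in> _\<close> that by (auto simp: space_PiM X_def input_dist_def PiE_def Pi_def)
    then show ?thesis
      unfolding F_def by (simp add: prediction_eq_linear_in_query[OF assms(7) _ assms(8,9)])
  qed
  have F_meas: "(\<lambda>z. F (fst z) (snd z)) \<in> borel_measurable (PiM {..n} (\<lambda>_. X) \<Otimes>\<^sub>M W)"
  proof -
    let ?N = "PiM {..n} (\<lambda>_. X) \<Otimes>\<^sub>M W"
    have x: "(\<lambda>z. fst z i) \<in> measurable ?N X" if "i \<le> n" for i
      using that by (intro measurable_compose[OF measurable_fst] measurable_component_singleton) auto
    have \<phi>x: "(\<lambda>z. \<phi> (fst z i) $ k) \<in> borel_measurable ?N" if "i \<le> n" "k < dbar" for i k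
      by (rule measurable_compose[OF x[OF that(1)] \<phi>_meas[OF that(2)]])
    have gx: "(\<lambda>z. g k (fst z i)) \<in> borel_measurable ?N" if "i \<le> n" "k < m" for i k
      by (rule measurable_compose[OF x[OF that(1)] g_meas[OF that(2)]])
    have w: "(\<lambda>z. snd z i) \<in> borel_measurable ?N" if "i < m" for i
      by (rule measurable_compose[OF measurable_snd w_meas[OF that]])
    have y: "(\<lambda>z. task_fun m g (snd z) (fst z i)) \<in> borel_measurable ?N" if "i \<le> n" for i
      unfolding task_fun_def using that
      by (intro borel_measurable_sum borel_measurable_times w gx) auto
    show ?thesis unfolding F_def
      by (intro borel_measurable_sum borel_measurable_times borel_measurable_add y
          borel_measurable_attn_coeff \<phi>x) auto
  qed
  have lower: "ennreal (\<Sum>l<K. (\<Sum>i<m. w i * c l i)\<^sup>2) \<le>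
      (\<integral>\<^sup>+x. ennreal ((F x w)\<^sup>2) \<partial>PiM {..n} (\<lambda>_. X))" if "w \<in> space W" for w
  proof -
    \<comment> \<open>Writing the index set as \<open>insert n {..<n}\<close> separates the query
      from the other samples, so that the query can be integrated first.\<close>
    have meas: "(\<lambda>x. ennreal ((F x w)\<^sup>2)) \<in> borel_measurable (PiM (insert n {..<n}) (\<lambda>_. X))"
      using measurable_compose[OF measurable_Pair2'[OF that] F_meas]
      by (simp add: lessThan_Suc[symmetric] lessThan_Suc_atMost)
    have "ennreal (\<Sum>l<K. (\<Sum>i<m. w i * c l i)\<^sup>2) =
        (\<integral>\<^sup>+x. ennreal (\<Sum>l<K. (\<Sum>i<m. w i * c l i)\<^sup>2) \<partial>PiM {..<n} (\<lambda>_. X))"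
      by (simp add: XJ.emeasure_space_1)
    also have "\<dots> \<le> (\<integral>\<^sup>+x. (\<integral>\<^sup>+q. ennreal ((F (x(n := q)) w)\<^sup>2) \<partial>X) \<partial>PiM {..<n} (\<lambda>_. X))"
    proof (rule nn_integral_mono)
      fix x
      \<comment> \<open>Changing coordinate \<open>n\<close> affects neither the context inputs nor
        their labels, hence the coefficients do not depend on \<open>q\<close>.\<close>
      have "F (x(n := q)) w =
          (\<Sum>k<dbar. attn_coeff dbar n \<phi> P Q x (\<lambda>i. task_fun m g w (x i)) k * \<phi> q $ k)
            + task_fun m g w q" for q
        unfolding F_def
        by (simp add: attn_coeff_cong[of n "x(n := q)" x _ "\<lambda>i. task_fun m g w (x i)"])
      then show "ennreal (\<Sum>l<K. (\<Sum>i<m. w i * c l i)\<^sup>2)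
          \<le> (\<integral>\<^sup>+q. ennreal ((F (x(n := q)) w)\<^sup>2) \<partial>X)"
        using orthogonal_linear_error_lower_bound[OF g h \<phi> orth] by simp
    qed
    also have "\<dots> = (\<integral>\<^sup>+x. ennreal ((F x w)\<^sup>2) \<partial>PiM (insert n {..<n}) (\<lambda>_. X))"
      using meas by (intro XS.product_nn_integral_insert[symmetric]) auto
    also have "insert n {..<n} = {..n}" by auto
    finally show ?thesis .
  qed
  \<comment> \<open>There are \<open>K = m - r\<close> vectors \<open>c l\<close>, each of norm
    1.\<close>
  have "real m - real r = (\<Sum>l<K. \<Sum>i<m. (c l i)\<^sup>2)"
    using c rm by (simp add: power2_eq_square K_def)
  also have "\<dots> = (\<integral>w. (\<Sum>l<K. (\<Sum>i<m. w i * c l i)\<^sup>2) \<partial>W)"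
    unfolding W_def
    by (subst Bochner_Integration.integral_sum) (auto simp: weight_dist_sum_square)
  finally have "ennreal (real m - real r) =
      ennreal (\<integral>w. (\<Sum>l<K. (\<Sum>i<m. w i * c l i)\<^sup>2) \<partial>W)" by simp
  also have "\<dots> = (\<integral>\<^sup>+w. ennreal (\<Sum>l<K. (\<Sum>i<m. w i * c l i)\<^sup>2) \<partial>W)"
    unfolding W_def
    by (intro nn_integral_eq_integral[symmetric] Bochner_Integration.integrable_sum
        weight_dist_sum_square AE_I2 sum_nonneg) auto
  also have "\<dots> \<le> (\<integral>\<^sup>+w. (\<integral>\<^sup>+x. ennreal ((F x w)\<^sup>2) \<partial>PiM {..n} (\<lambda>_. X)) \<partial>W)"
    by (intro nn_integral_mono lower)
  \<comment> \<open>Tonelli for the nonnegative integrand; an infinite loss is covered as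
    well.\<close>
  also have "\<dots> = (\<integral>\<^sup>+z. ennreal ((F (fst z) (snd z))\<^sup>2) \<partial>(PiM {..n} (\<lambda>_. X) \<Otimes>\<^sub>M W))"
    using XW.nn_integral_snd[of "\<lambda>z. ennreal ((F (fst z) (snd z))\<^sup>2)"] F_meas by simp
  also have "\<dots> = icl_loss d D m g dbar n FF P Q"
    unfolding icl_loss_def X_def[symmetric] W_def[symmetric]
    by (intro nn_integral_cong) (auto simp: space_pair_measure F_eq)
  finally show ?thesis by (simp add: r_def X_def)
qed

end
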